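(* Let $f:(0,\infty)\to\mathbb{R}$ be continuously differentiable with $f(x)>0$ for all $x>0$, $f'(x)>0$ for all $x>0$, and $f'(x)\to 0$ as $x\to\infty$. Suppose that the limit $$\lambda:=\lim_{x\to\infty}\frac{f(x)}{x/\log x}\in[0,\infty]$$ exists. Let $\mu$ be a positive finite Borel measure on $[0,\infty)$ with $M:=\int_{[0,\infty)}\mu(ds)\in(0,\infty)$. Let $\psi>0$ and let $x$ be the unique continuous solution of $$x'(t)=\int_{[0,t]}\mu(ds)\,f(x(t-s)),\quad t\ge 0;\qquad x(0)=\psi.$$ Let $F(x)=\int_1^x \frac{1}{f(u)}\,du$ for $x>0$. (i) If $$\lim_{x\to\infty}\frac{f(x)}{x/\log x}\int_{[0,F(x)/M]}s\,\mu(ds)=0 \quad\text{and}\quad \lim_{x\to\infty}\frac{f(x)}{x}\int_{[0,F(x)/M]}\int_{[s,\infty)}\mu(du)\,ds=0,$$ then $$\lim_{t\to\infty}\frac{x(t)}{F^{-1}(Mt)}=1.$$ (ii) If $$\lim_{x\to\infty}\frac{f(x)}{x}\int_{[0,F(x)/M]}\int_{[s,\infty)}\mu(du)\,ds=+\infty,$$ then $$\lim_{t\to\infty}\frac{x(t)}{F^{-1}(Mt)}=0.$$ (iii) If $f'$ is decreasing on $[x_2,\infty)$ for some $x_2>0$, then $$\lim_{t\to\infty}\frac{x(t)}{F^{-1}(Mt)}=1 \quad\text{implies}\quad \lim_{x\to\infty}\frac{f(x)}{x}\int_{[0,F(x)/M]}\int_{[s,\infty)}\mu(du)\,ds=0.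$$
   Context: The function $F$ is strictly increasing and $F(x)\to\infty$ as $x\to\infty$ (since $f(x)/x\to0$), so $F^{-1}(Mt)$ is defined for all $t\ge0$. Since $\mu$ may have atoms, the solution is understood as a continuous (locally absolutely continuous) function $x:[0,\infty)\to(0,\infty)$ satisfying the equation in integrated form, i.e. for almost every $t\ge0$. *)

theory Defs
  imports "HOL-Analysis.Analysis"
begin

text \<open>For \<open>x < 1\<close> the interval integral is the oriented one, so \<open>Fint f x\<close> is negative there.\<close>

definition Fint :: "(real \<Rightarrow> real) \<Rightarrow> real \<Rightarrow> real" where
  "Fint f x = (LBINT u=ereal 1..ereal x. 1 / f u)"

definition Fint_inv :: "(real \<Rightarrow> real) \<Rightarrow> real \<Rightarrow> real" where
  "Fint_inv f = inv_into {0<..} (Fint f)"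

definition borel_measure_on_halfline :: "real measure \<Rightarrow> bool" where
  "borel_measure_on_halfline \<mu> \<longleftrightarrow> sets \<mu> = sets (restrict_space borel {0::real..})"

definition delay_rhs :: "(real \<Rightarrow> real) \<Rightarrow> real measure \<Rightarrow> (real \<Rightarrow> real) \<Rightarrow> real \<Rightarrow> real" where
  "delay_rhs f \<mu> x t = (LINT s:{0..t}|\<mu>. f (x (t - s)))"

text \<open>
  The measure may have atoms, so the right-hand side need not be continuous in \<open>t\<close> and the
  initial value problem \<open>x' = delay_rhs f \<mu> x\<close>, \<open>x 0 = \<psi>\<close> is read in integrated form.
  Only the values of \<open>x\<close> on \<open>{0..}\<close> matter.
\<close>

definition delay_solution ::
  "(real \<Rightarrow> real) \<Rightarrow> real measure \<Rightarrow> real \<Rightarrow> (real \<Rightarrow> real) \<Rightarrow> bool" where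
  "delay_solution f \<mu> \<psi> x \<longleftrightarrow>
     continuous_on {0..} x \<and> (\<forall>t\<ge>0. 0 < x t) \<and> x 0 = \<psi> \<and>
     (\<forall>t\<ge>0. (delay_rhs f \<mu> x has_integral (x t - \<psi>)) {0..t})"

definition tail_integral :: "real measure \<Rightarrow> real \<Rightarrow> real" where
  "tail_integral \<mu> T = (LBINT s:{0..T}. measure \<mu> {s..})"

definition truncated_moment :: "real measure \<Rightarrow> real \<Rightarrow> real" where
  "truncated_moment \<mu> T = (LINT s:{0..T}|\<mu>. s)"

end

theory Submission
  imports Defs
begin

text \<open>
  Put \<open>y t = Fint_inv f (M t)\<close>, \<open>R t = tail_integral \<mu> t\<close> and \<open>m t = truncated_moment \<mu> t\<close>. The solution is
  nondecreasing, so \<open>f (x (t - s)) \<le> f (x t)\<close>, and \<open>1 - a \<le> - ln a\<close> bounds the defect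
  \<open>1 - f (x (t - s)) / f (x t)\<close> by an increment of \<open>ln (f (x t))\<close>. Integrating \<open>x' / f x\<close> and using
  Fubini on the increments gives
  \<open>F \<psi> + M t - R t - m t (ln (f (x t)) - ln (f \<psi>)) \<le> F (x t) \<le> F \<psi> + M t - R t\<close>.
  As \<open>F y - F x\<close> lies between \<open>(y - x) / f y\<close> and \<open>(y - x) / f x\<close> for \<open>x \<le> y\<close>, both inequalities
  together yield (i), and the right one yields (iii), where concavity gives \<open>f y / f x \<rightarrow> 1\<close>. For (ii), the hypothesis bounds \<open>1 / f u\<close> by \<open>R t / (K u)\<close> on
  \<open>[x t, y t]\<close>, so \<open>R t - F \<psi> \<le> (R t / K) ln (y t / x t)\<close> with \<open>K\<close> arbitrarily large.
\<close>

section \<open>A chain rule for solutions in integrated form\<close>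

text \<open>\<open>D\<close> need not be a derivative of \<open>x\<close> at any given point. But on \<open>{s..t}\<close> the integral of \<open>p D\<close>
  and the increment of \<open>H\<close> differ by at most \<open>(p s - p t) K (t - s)\<close>, so their difference has
  derivative zero everywhere.\<close>

lemma stieltjes_chain_rule:
  fixes p D H x :: "real \<Rightarrow> real"
  assumes ab: "a \<le> b"
    and D: "\<And>t. t \<in> {a..b} \<Longrightarrow> (D has_integral (x t - x a)) {a..t}"
    and D_nonneg: "\<And>t. t \<in> {a..b} \<Longrightarrow> 0 \<le> D t"
    and D_bound: "\<And>t. t \<in> {a..b} \<Longrightarrow> D t \<le> K"
    and p_cont: "continuous_on {a..b} p"
    and p_anti: "\<And>s t. a \<le> s \<Longrightarrow> s \<le> t \<Longrightarrow> t \<le> b \<Longrightarrow> p t \<le> p s"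
    and H_lower: "\<And>s t. a \<le> s \<Longrightarrow> s \<le> t \<Longrightarrow> t \<le> b \<Longrightarrow> p t * (x t - x s) \<le> H t - H s"
    and H_upper: "\<And>s t. a \<le> s \<Longrightarrow> s \<le> t \<Longrightarrow> t \<le> b \<Longrightarrow> H t - H s \<le> p s * (x t - x s)"
  shows "((\<lambda>t. p t * D t) has_integral (H b - H a)) {a..b}"
proof -
  have D_part: "(D has_integral (x t - x s)) {s..t}" if "a \<le> s" "s \<le> t" "t \<le> b" for s t
  proof -
    have "D integrable_on {s..t}"
      using integrable_subinterval_real[of D a t s t] D[of t] that
      by (auto simp: integrable_on_def)
    then obtain j where j: "(D has_integral j) {s..t}" by (auto simp: integrable_on_def)
    have "(D has_integral (x s - x a + j)) {a..t}"
      by (rule has_integral_combine[OF _ _ D j]) (use that in auto)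
    with D[of t] that have "x t - x a = x s - x a + j"
      by (auto dest: has_integral_unique)
    with j show ?thesis by (simp add: algebra_simps)
  qed
  have "D absolutely_integrable_on {a..b}"
    using D[of b] ab D_nonneg by (intro nonnegative_absolutely_integrable_1) (auto simp: integrable_on_def)
  moreover have "p \<in> borel_measurable (lebesgue_on {a..b})"
    by (intro continuous_imp_measurable_on_sets_lebesgue p_cont) auto
  moreover have "bounded (p ` {a..b})"
    by (intro compact_imp_bounded compact_continuous_image p_cont) auto
  ultimately have "(\<lambda>t. p t * D t) absolutely_integrable_on {a..b}"
    by (intro absolutely_integrable_bounded_measurable_product_real) auto
  then have pD: "(\<lambda>t. p t * D t) integrable_on {a..b}"
    by (rule set_lebesgue_integral_eq_integral)
  define q where "q t = integral {a..t} (\<lambda>t. p t * D t)" for t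
  have *: "\<bar>(q t - H t) - (q s - H s)\<bar> \<le> \<bar>p t - p s\<bar> * (K * \<bar>t - s\<bar>)"
    if st: "a \<le> s" "s \<le> t" "t \<le> b" for s t
  proof -
    have int: "((\<lambda>t. p t * D t) has_integral integral {s..t} (\<lambda>t. p t * D t)) {s..t}"
      using integrable_subinterval_real[OF pD, of s t] st by (auto intro: integrable_integral)
    have q: "q t - q s = integral {s..t} (\<lambda>t. p t * D t)"
      unfolding q_def
      using Henstock_Kurzweil_Integration.integral_combine[of a s t "\<lambda>t. p t * D t"] integrable_subinterval_real[OF pD, of a t] st
      by auto
    \<comment> \<open>On \<open>{s..t}\<close> the integrand lies between \<open>p t * D\<close> and
      \<open>p s * D\<close>. So the increments of \<open>q\<close> and of \<open>H\<close> lie in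
      one interval, of length \<open>(p s - p t) * (x t - x s)\<close>.\<close>
    have "p t * (x t - x s) \<le> q t - q s"
      unfolding q by (rule has_integral_le[OF has_integral_mult_right[OF D_part] int])
        (use st in \<open>auto intro!: mult_right_mono p_anti D_nonneg\<close>)
    moreover have "q t - q s \<le> p s * (x t - x s)"
      unfolding q by (rule has_integral_le[OF int has_integral_mult_right[OF D_part]])
        (use st in \<open>auto intro!: mult_right_mono p_anti D_nonneg\<close>)
    ultimately have "\<bar>(q t - H t) - (q s - H s)\<bar> \<le> (p s - p t) * (x t - x s)"
      using H_lower[OF st] H_upper[OF st] by (auto simp: abs_le_iff algebra_simps)
    also have "x t - x s \<le> K * (t - s)"
      using has_integral_le[OF D_part[OF st] has_integral_const_real[of K s t]] D_bound st
      by (auto simp: mult.commute)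
    then have "(p s - p t) * (x t - x s) \<le> (p s - p t) * (K * (t - s))"
      using p_anti[OF st] by (intro mult_left_mono) auto
    finally show ?thesis using p_anti[OF st] st by auto
  qed
  have **: "\<bar>(q t - H t) - (q s - H s)\<bar> \<le> \<bar>p t - p s\<bar> * (K * \<bar>t - s\<bar>)"
    if "s \<in> {a..b}" "t \<in> {a..b}" for s t
    using *[of s t] *[of t s] that by (cases "s \<le> t") (auto simp: abs_minus_commute)
  have "((\<lambda>t. q t - H t) has_field_derivative 0) (at s within {a..b})" if s: "s \<in> {a..b}" for s
    unfolding has_field_derivative_iff
  proof (rule Lim_null_comparison)
    show "\<forall>\<^sub>F t in at s within {a..b}. norm ((q t - H t - (q s - H s)) / (t - s)) \<le> \<bar>p t - p s\<bar> * K"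
      unfolding eventually_at_filter
    proof (intro always_eventually allI impI)
      fix t assume "t \<noteq> s" "t \<in> {a..b}"
      with **[OF s, of t] show "norm ((q t - H t - (q s - H s)) / (t - s)) \<le> \<bar>p t - p s\<bar> * K"
        by (simp add: abs_mult divide_simps mult_ac)
    qed
    have "(p \<longlongrightarrow> p s) (at s within {a..b})" using p_cont s by (auto simp: continuous_on_def)
    then have "((\<lambda>t. \<bar>p t - p s\<bar> * K) \<longlongrightarrow> \<bar>p s - p s\<bar> * K) (at s within {a..b})"
      by (intro tendsto_intros)
    then show "((\<lambda>t. \<bar>p t - p s\<bar> * K) \<longlongrightarrow> 0) (at s within {a..b})" by simp
  qed
  then have "\<exists>c. \<forall>s\<in>{a..b}. q s - H s = c"
    by (intro has_field_derivative_zero_constant) auto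
  then obtain c where "\<And>s. s\<in>{a..b} \<Longrightarrow> q s - H s = c" by auto
  from this[of a] this[of b] ab have "q b - H b = q a - H a" by auto
  moreover have "q a = 0" by (simp add: q_def)
  ultimately have "integral {a..b} (\<lambda>t. p t * D t) = H b - H a" by (simp add: q_def)
  with pD show ?thesis by (metis integrable_integral)
qed

section \<open>The nonlinearity \<open>f\<close>, the function \<open>Fint f\<close> and its
  inverse\<close>

locale sublinear_growth =
  fixes f f' :: "real \<Rightarrow> real"
  assumes f_deriv: "\<And>u. u > 0 \<Longrightarrow> (f has_real_derivative f' u) (at u)"
    and f_pos: "\<And>u. u > 0 \<Longrightarrow> f u > 0"
    and f'_pos: "\<And>u. u > 0 \<Longrightarrow> f' u > 0"
    and f'_lim: "(f' \<longlongrightarrow> 0) at_top"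
begin

lemma f_mono:
  assumes "0 < u" "u \<le> v" shows "f u \<le> f v"
proof (rule DERIV_nonneg_imp_nondecreasing[OF assms(2)])
  fix w assume "u \<le> w"
  with assms(1) have "0 < w" by simp
  then show "\<exists>y. (f has_real_derivative y) (at w) \<and> 0 \<le> y"
    using f_deriv[of w] f'_pos[of w] by (intro exI[of _ "f' w"]) simp
qed

lemma f_continuous_on: "S \<subseteq> {0<..} \<Longrightarrow> continuous_on S f"
  by (rule continuous_at_imp_continuous_on) (auto intro: DERIV_isCont f_deriv)

lemma f_over_id_tendsto_0: "((\<lambda>u. f u / u) \<longlongrightarrow> 0) at_top"
proof (rule lhospital_at_top_at_top[where f'=f' and g'="\<lambda>_. 1"])
  show "\<forall>\<^sub>F u in at_top. (f has_real_derivative f' u) (at u)"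
    using eventually_gt_at_top[of 0] by eventually_elim (rule f_deriv)
qed (use f'_lim in \<open>auto intro: filterlim_ident\<close>)

lemma f_le_id_eventually: "\<forall>\<^sub>F u in at_top. f u \<le> u"
  using order_tendstoD(2)[OF f_over_id_tendsto_0 zero_less_one] eventually_gt_at_top[of 0]
  by eventually_elim (simp add: divide_simps)

lemma Fint_deriv: 
  assumes "u > 0" shows "(Fint f has_real_derivative 1 / f u) (at u)"
proof -
  \<comment> \<open>A compact interval of positive numbers with 1 and \<open>u\<close> in its
    interior: the fundamental theorem then gives a two-sided derivative, for \<open>u\<close> below
    1 as well.\<close>
  define a b where "a = min 1 u / 2" and "b = max 1 u + 1"
  have ab: "0 < a" "a < 1" "1 < b" "a < u" "u < b" using assms by (auto simp: a_def b_def min_def max_def)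
  have "((\<lambda>v. LBINT y=ereal 1..ereal v. 1 / f y) has_vector_derivative 1 / f u) (at u within {a..b})"
    using ab f_pos by (intro interval_integral_FTC2 continuous_intros f_continuous_on) (auto simp: less_imp_neq[symmetric])
  then have "(Fint f has_real_derivative 1 / f u) (at u within {a..b})"
    unfolding has_real_derivative_iff_has_vector_derivative Fint_def[abs_def] by simp
  then show ?thesis using ab by (simp add: at_within_Icc_at)
qed

lemma Fint_continuous_on: "S \<subseteq> {0<..} \<Longrightarrow> continuous_on S (Fint f)"
  by (rule continuous_at_imp_continuous_on) (auto intro: DERIV_isCont Fint_deriv)

lemma Fint_1 [simp]: "Fint f 1 = 0"
  by (simp add: Fint_def)

text \<open>The derivative \<open>1 / f\<close> is nonincreasing, so the mean value theorem bounds
  the increment by its endpoint values.\<close>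

lemma Fint_diff_bounds:
  assumes "0 < a" "a \<le> b"
  shows "(b - a) / f b \<le> Fint f b - Fint f a" "Fint f b - Fint f a \<le> (b - a) / f a"
proof -
  have "\<exists>z. a \<le> z \<and> z \<le> b \<and> Fint f b - Fint f a = (b - a) * (1 / f z)"
  proof (cases "a = b")
    case False
    with assms have "a < b" by simp
    then obtain z where "a < z" "z < b" "Fint f b - Fint f a = (b - a) * (1 / f z)"
      using MVT2[of a b "Fint f" "\<lambda>u. 1 / f u"] Fint_deriv assms(1) by (metis order_less_le_trans)
    then show ?thesis by (intro exI[of _ z]) simp
  qed auto
  then obtain z where z: "a \<le> z" "z \<le> b" "Fint f b - Fint f a = (b - a) * (1 / f z)" by blast
  have "f a \<le> f z" "f z \<le> f b" "0 < f a" using z assms by (auto intro: f_mono f_pos)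
  then show "(b - a) / f b \<le> Fint f b - Fint f a" "Fint f b - Fint f a \<le> (b - a) / f a"
    using assms by (auto simp: z(3) intro!: frac_le)
qed

lemma Fint_strict_mono: "0 < a \<Longrightarrow> a < b \<Longrightarrow> Fint f a < Fint f b"
  using Fint_diff_bounds(1)[of a b] f_pos[of b] by (smt (verit) divide_pos_pos)

lemma Fint_less_iff: "0 < a \<Longrightarrow> 0 < b \<Longrightarrow> Fint f a < Fint f b \<longleftrightarrow> a < b"
  using Fint_strict_mono by (metis less_asym linorder_neqE)

lemma Fint_mono: "0 < a \<Longrightarrow> a \<le> b \<Longrightarrow> Fint f a \<le> Fint f b"
  using Fint_strict_mono[of a b] by (cases "a = b") auto

text \<open>Comparison of derivatives: \<open>c * ln u - Fint f u\<close> is nondecreasing. This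
  turns information on \<open>f u / u\<close> into a bound involving the ratio of the
  endpoints.\<close>

lemma Fint_diff_le_ln:
  assumes "0 < a" "a \<le> b" "\<And>u. a \<le> u \<Longrightarrow> u \<le> b \<Longrightarrow> 1 / f u \<le> c / u"
  shows "Fint f b - Fint f a \<le> c * (ln b - ln a)"
proof -
  have "c * ln a - Fint f a \<le> c * ln b - Fint f b"
  proof (rule DERIV_nonneg_imp_nondecreasing[OF assms(2)])
    fix u assume u: "a \<le> u" "u \<le> b"
    have "((\<lambda>u. c * ln u - Fint f u) has_real_derivative c * (1 / u) - 1 / f u) (at u)"
      using assms(1) u by (auto intro!: derivative_eq_intros Fint_deriv)
    then show "\<exists>y. ((\<lambda>u. c * ln u - Fint f u) has_real_derivative y) (at u) \<and> 0 \<le> y"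
      using assms(3)[OF u] by auto
  qed
  then show ?thesis by (simp add: algebra_simps)
qed

text \<open>Eventually \<open>f u \<le> u\<close>, so \<open>Fint f - ln\<close> is eventually
  nondecreasing and \<open>Fint f\<close> dominates a shifted logarithm.\<close>

lemma Fint_at_top: "filterlim (Fint f) at_top at_top"
proof -
  obtain u0 where u0: "u0 \<ge> 1" "\<And>u. u \<ge> u0 \<Longrightarrow> f u \<le> u"
    using f_le_id_eventually unfolding eventually_at_top_linorder by (metis max.cobounded2 max.bounded_iff)
  have "\<forall>\<^sub>F u in at_top. Fint f u0 - ln u0 + ln u \<le> Fint f u"
    using eventually_ge_at_top[of u0]
  proof eventually_elim
    case (elim u)
    have "Fint f u0 - ln u0 \<le> Fint f u - ln u"
    proof (rule DERIV_nonneg_imp_nondecreasing[OF elim])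
      fix v assume v: "u0 \<le> v" "v \<le> u"
      have "((\<lambda>u. Fint f u - ln u) has_real_derivative 1 / f v - 1 / v) (at v)"
        using u0 v by (auto intro!: derivative_eq_intros Fint_deriv)
      moreover have "1 / v \<le> 1 / f v" using u0(1) u0(2)[of v] v f_pos[of v] by (auto intro!: frac_le)
      ultimately show "\<exists>y. ((\<lambda>u. Fint f u - ln u) has_real_derivative y) (at v) \<and> 0 \<le> y"
        by auto
    qed
    then show ?case by simp
  qed
  moreover have "filterlim (\<lambda>u::real. Fint f u0 - ln u0 + ln u) at_top at_top"
    by (intro filterlim_tendsto_add_at_top[OF tendsto_const] ln_at_top)
  ultimately show ?thesis by (rule filterlim_at_top_mono[rotated])
qed

text \<open>Values \<open>w \<ge> 0\<close> are attained on \<open>{1..}\<close>, since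
  \<open>Fint f 1 = 0\<close> and \<open>Fint f\<close> is unbounded above. Negative values can be
  missed, namely if \<open>1 / f\<close> is integrable near 0.\<close>

lemma Fint_inv:
  assumes "w \<ge> 0" shows "Fint_inv f w > 0" "Fint f (Fint_inv f w) = w"
proof -
  obtain b where b: "b \<ge> 1" "Fint f b \<ge> w"
    using filterlim_at_top[THEN iffD1, OF Fint_at_top, rule_format, of w]
    unfolding eventually_at_top_linorder by (metis max.cobounded1 max.cobounded2)
  have "\<exists>u\<ge>1. u \<le> b \<and> Fint f u = w"
    by (rule IVT') (use assms b in \<open>auto intro!: Fint_continuous_on\<close>)
  then have "w \<in> Fint f ` {0<..}" by force
  then show "Fint_inv f w > 0" "Fint f (Fint_inv f w) = w"
    unfolding Fint_inv_def using inv_into_into[of w "Fint f" "{0<..}"] f_inv_into_f[of w "Fint f" "{0<..}"] by auto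
qed

lemma Fint_inv_at_top: "filterlim (Fint_inv f) at_top at_top"
  unfolding filterlim_at_top
proof
  fix Z :: real
  define Z' where "Z' = max Z 1"
  show "\<forall>\<^sub>F w in at_top. Z \<le> Fint_inv f w"
    using eventually_ge_at_top[of "max 0 (Fint f Z')"]
  proof eventually_elim
    case (elim w)
    then have "\<not> Fint_inv f w < Z'"
      using Fint_inv[of w] Fint_strict_mono[of "Fint_inv f w" Z'] by auto
    then show ?case by (simp add: Z'_def)
  qed
qed

text \<open>As \<open>f'\<close> tends to 0, the slope of \<open>f\<close> is eventually below
  \<open>\<epsilon>\<close>. In the upper bound for \<open>x t / y t\<close> this exchanges
  \<open>f (x t)\<close> for \<open>f (y t)\<close>.\<close>

lemma f_increment_eventually:
  assumes "\<epsilon> > 0"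
  obtains u0 where "u0 > 0" "\<And>a b. u0 \<le> a \<Longrightarrow> a \<le> b \<Longrightarrow> f b - f a \<le> \<epsilon> * (b - a)"
proof -
  obtain u0 where u0: "\<And>u. u0 \<le> u \<Longrightarrow> f' u < \<epsilon>"
    using order_tendstoD(2)[OF f'_lim assms] by (auto simp: eventually_at_top_linorder)
  show thesis
  proof (rule that[of "max u0 1"])
    fix a b assume ab: "max u0 1 \<le> a" "a \<le> b"
    have "\<epsilon> * a - f a \<le> \<epsilon> * b - f b"
    proof (rule DERIV_nonneg_imp_nondecreasing[OF ab(2)])
      fix u assume "a \<le> u"
      with ab have u: "u0 \<le> u" "0 < u" by auto
      have "((\<lambda>u. \<epsilon> * u - f u) has_real_derivative \<epsilon> - f' u) (at u)"
        using f_deriv[OF u(2)] by (auto intro!: derivative_eq_intros)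
      then show "\<exists>y. ((\<lambda>u. \<epsilon> * u - f u) has_real_derivative y) (at u) \<and> 0 \<le> y"
        using u0[OF u(1)] by (intro exI[of _ "\<epsilon> - f' u"]) simp
    qed
    then show "f b - f a \<le> \<epsilon> * (b - a)" by (simp add: algebra_simps)
  qed simp
qed

text \<open>Concavity beyond \<open>c\<close>: \<open>f b - f a\<close> is at most
  \<open>(b - a) * f' a\<close>, and \<open>f' a\<close> is at most the slope of the chord over
  \<open>{c..a}\<close>, hence at most \<open>2 * f a / a\<close>.\<close>

lemma f_ratio_le_of_antimono:
  assumes c: "0 < c" "antimono_on {c..} f'" and ab: "2 * c \<le> a" "a < b"
  shows "f b / f a \<le> 1 + 2 * (b / a - 1)"
proof -
  have le: "f' v \<le> f' u" if "c \<le> u" "u \<le> v" for u v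
    using monotone_onD[OF c(2), of u v] that by simp
  have a: "0 < a" "c < a" using c ab by auto
  obtain z where z: "a < z" "z < b" "f b - f a = (b - a) * f' z"
    using MVT2[OF ab(2), of f f'] f_deriv a by (metis order_less_le_trans)
  obtain w where w: "c < w" "w < a" "f a - f c = (a - c) * f' w"
    using MVT2[OF a(2), of f f'] f_deriv c by (metis order_less_le_trans)
  \<comment> \<open>Here \<open>2 * c \<le> a\<close> yields \<open>a / 2 \<le> a - c\<close>, the
    source of the factor 2.\<close>
  have "(a / 2) * f' a \<le> (a - c) * f' w"
    using ab a le[of w a] w f'_pos[of a] by (intro mult_mono) auto
  also have "\<dots> \<le> f a" using w f_pos[of c] c by linarith
  finally have f'a: "f' a \<le> 2 * f a / a" using a by (simp add: field_simps)
  have "f b - f a \<le> (b - a) * f' a"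
    unfolding z(3) using ab a z le[of a z] by (intro mult_left_mono) auto
  also have "\<dots> \<le> (b - a) * (2 * f a / a)"
    using f'a ab by (intro mult_left_mono) auto
  finally have "f b \<le> f a * (1 + 2 * (b / a - 1))"
    using a by (simp add: field_simps)
  then show ?thesis using f_pos[OF a(1)] by (simp add: divide_le_eq mult.commute)
qed

end

text \<open>After a shift everything cancels except the integrals over \<open>{T - r..T}\<close> and
  \<open>{0..r}\<close>, both of length \<open>r\<close>. Integrated against \<open>\<mu>\<close>,
  this factor \<open>r\<close> becomes the truncated moment.\<close>

lemma integral_delayed_increment_le:
  fixes L :: "real \<Rightarrow> real"
  assumes L_cont: "continuous_on UNIV L" and L_mono: "mono L" and r: "0 \<le> r" "r \<le> T"
  shows "integral {r..T} (\<lambda>s. L s - L (s - r)) \<le> r * (L T - L 0)"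
proof -
  have int: "L integrable_on {a..b}" for a b
    by (intro integrable_continuous_interval continuous_on_subset[OF L_cont]) auto
  have shift: "integral {r..T} (\<lambda>s. L (s - r)) = integral {0..T - r} L"
    using integral_shift[of r "-r" T L] continuous_on_subset[OF L_cont] by (simp add: comp_def)
  have shift_int: "(\<lambda>s. L (s - r)) integrable_on {r..T}"
    by (intro integrable_continuous_interval continuous_on_compose2[OF L_cont]) (auto intro!: continuous_intros)
  have "integral {r..T} (\<lambda>s. L s - L (s - r)) = integral {r..T} L - integral {0..T - r} L"
    using integral_diff[OF int shift_int] by (simp add: shift)
  \<comment> \<open>Completing both integrals to \<open>{0..T}\<close> also covers the case that
    \<open>{r..T}\<close> and \<open>{0..T - r}\<close> are disjoint.\<close>
  also have "\<dots> = integral {T - r..T} L - integral {0..r} L"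
    using Henstock_Kurzweil_Integration.integral_combine[of 0 r T L]
      Henstock_Kurzweil_Integration.integral_combine[of 0 "T - r" T L] int r by simp
  also have "\<dots> \<le> r * L T - r * L 0"
  proof (rule diff_mono)
    show "integral {T - r..T} L \<le> r * L T"
      using integral_le[OF int, of "\<lambda>_. L T" "T - r" T] r L_mono by (auto simp: mono_def)
    show "r * L 0 \<le> integral {0..r} L"
      using integral_le[OF _ int, of "\<lambda>_. L 0" 0 r] r L_mono by (auto simp: mono_def)
  qed
  finally show ?thesis by (simp add: algebra_simps)
qed

section \<open>The measure, the solution, and the logarithm of \<open>f\<close> along it\<close>

locale delay_equation = sublinear_growth f f' + finite_measure \<mu>
  for f f' :: "real \<Rightarrow> real" and \<mu> :: "real measure" +
  fixes x :: "real \<Rightarrow> real" and M \<psi> :: real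
  assumes mu_borel: "borel_measure_on_halfline \<mu>"
    and M_def: "M = measure \<mu> {0..}"
    and sol: "delay_solution f \<mu> \<psi> x"
begin

lemma sets_mu: "sets \<mu> = sets (restrict_space borel {0..})"
  using mu_borel by (simp add: borel_measure_on_halfline_def)

lemma space_mu: "space \<mu> = {0..}"
  using sets_eq_imp_space_eq[OF sets_mu] by (simp add: space_restrict_space)

lemma sets_mu_iff: "A \<in> sets \<mu> \<longleftrightarrow> A \<in> sets borel \<and> A \<subseteq> {0..}"
  unfolding sets_mu by (subst sets_restrict_space_iff) auto

lemma borel_measurable_mu: "g \<in> borel_measurable borel \<Longrightarrow> g \<in> borel_measurable \<mu>"
  unfolding measurable_cong_sets[OF sets_mu refl] by (rule measurable_restrict_space1)

lemma M_eq: "M = measure \<mu> (space \<mu>)"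
  by (simp add: M_def space_mu)

lemma M_nonneg: "0 \<le> M"
  by (simp add: M_def)

lemma x_cont: "continuous_on {0..} x" and x_pos: "0 \<le> t \<Longrightarrow> 0 < x t" and x_0: "x 0 = \<psi>"
  and x_integral: "0 \<le> t \<Longrightarrow> (delay_rhs f \<mu> x has_integral (x t - \<psi>)) {0..t}"
  using sol by (auto simp: delay_solution_def)

lemma delay_rhs_nonneg: "0 \<le> delay_rhs f \<mu> x t"
  unfolding delay_rhs_def set_lebesgue_integral_def
  by (intro Bochner_Integration.integral_nonneg) (auto simp: indicator_def less_imp_le[OF f_pos[OF x_pos]])

text \<open>The right-hand side of the equation is nonnegative, so its integral grows with the
  interval.\<close>

lemma x_mono: "0 \<le> s \<Longrightarrow> s \<le> t \<Longrightarrow> x s \<le> x t"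
  using has_integral_subset_le[OF _ x_integral x_integral, of s t] delay_rhs_nonneg by auto

text \<open>Extending the solution by its initial value makes all integrands below defined on the
  whole line.\<close>

definition log_f :: "real \<Rightarrow> real" where
  "log_f t = ln (f (x (max 0 t)))"

lemma f_x_pos: "0 < f (x (max 0 t))"
  by (intro f_pos x_pos) auto

lemma f_x_eq: "f (x (max 0 t)) = exp (log_f t)"
  by (simp add: log_f_def f_x_pos)

lemma exp_log_f: "0 \<le> t \<Longrightarrow> exp (log_f t) = f (x t)"
  by (simp add: f_x_eq[symmetric] max_def)

lemma log_f_cont: "continuous_on UNIV log_f"
proof -
  have "continuous_on UNIV (\<lambda>t. x (max 0 t))"
    by (rule continuous_on_compose2[OF x_cont]) (auto intro!: continuous_intros)
  then have "continuous_on UNIV (\<lambda>t. f (x (max 0 t)))"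
    by (rule continuous_on_compose2[OF f_continuous_on[OF order_refl]]) (auto intro: x_pos)
  then show ?thesis
    unfolding log_f_def[abs_def] using f_x_pos by (intro continuous_on_ln) (auto simp: less_imp_neq[symmetric])
qed

lemma log_f_mono: "mono log_f"
  unfolding log_f_def using f_x_pos
  by (intro monoI ln_mono f_mono x_mono) (auto intro: x_pos)

lemma log_f_measurable [measurable]: "log_f \<in> borel_measurable borel"
  by (rule borel_measurable_continuous_onI[OF log_f_cont])

section \<open>Bounds for the right-hand side in terms of \<open>f (x t)\<close>\<close>

lemma delay_rhs_eq: "delay_rhs f \<mu> x t = (\<integral>s. indicator {..t} s * exp (log_f (t - s)) \<partial>\<mu>)"
  unfolding delay_rhs_def set_lebesgue_integral_def
  by (intro Bochner_Integration.integral_cong)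
     (auto simp: space_mu indicator_def f_x_eq[symmetric])

lemma integrable_mu_bounded:
  fixes g :: "real \<Rightarrow> real"
  assumes "g \<in> borel_measurable borel" "\<And>s. 0 \<le> s \<Longrightarrow> \<bar>g s\<bar> \<le> c"
  shows "integrable \<mu> g"
  using assms by (intro integrable_const_bound[of _ c] borel_measurable_mu) (auto simp: space_mu)

lemma integral_indicator_mu:
  fixes c :: real
  assumes "0 \<le> t" shows "(\<integral>s. indicator {..t} s * c \<partial>\<mu>) = c * measure \<mu> {0..t}"
proof -
  have "(\<integral>s. indicator {..t} s * c \<partial>\<mu>) = (\<integral>s. indicator {0..t} s * c \<partial>\<mu>)"
    by (intro Bochner_Integration.integral_cong) (auto simp: space_mu indicator_def)
  also have "\<dots> = c * measure \<mu> {0..t}"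
    by (simp add: space_mu Int_absorb2 atLeastAtMost_def)
  finally show ?thesis .
qed

text \<open>The logarithmic losses \<open>ln (f (x t) / f (x (t - s)))\<close> averaged over the
  delays up to \<open>t\<close>. They bound the relative amount by which the right-hand side falls
  short of \<open>f (x t) * measure \<mu> {0..t}\<close>.\<close>

definition log_f_defect :: "real \<Rightarrow> real" where
  "log_f_defect t = (\<integral>s. indicator {..t} s * (log_f t - log_f (t - s)) \<partial>\<mu>)"

lemma log_f_increment_bounds:
  assumes "0 \<le> s" "s \<le> t" "t \<le> T"
  shows "0 \<le> log_f t - log_f (t - s)" "log_f t - log_f (t - s) \<le> log_f T - log_f 0"
  using assms monoD[OF log_f_mono, of "t - s" t] monoD[OF log_f_mono, of t T]
    monoD[OF log_f_mono, of 0 "t - s"] by auto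

lemma delay_rhs_le:
  assumes "0 \<le> t" shows "delay_rhs f \<mu> x t \<le> f (x t) * measure \<mu> {0..t}"
proof -
  have le: "exp (log_f (t - s)) \<le> exp (log_f t)" if "0 \<le> s" for s
    using monoD[OF log_f_mono, of "t - s" t] that by simp
  have "delay_rhs f \<mu> x t \<le> (\<integral>s. indicator {..t} s * exp (log_f t) \<partial>\<mu>)"
    unfolding delay_rhs_eq
  proof (intro integral_mono integrable_mu_bounded[where c="exp (log_f t)"])
    show "indicator {..t} s * exp (log_f (t - s)) \<le> indicator {..t} s * exp (log_f t)" if "s \<in> space \<mu>" for s
      using that le[of s] by (auto simp: space_mu indicator_def)
  qed (use le in \<open>auto simp: indicator_def\<close>)
  then show ?thesis by (simp only: integral_indicator_mu[OF assms] exp_log_f[OF assms])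
qed

text \<open>This is \<open>1 - a \<le> - ln a\<close>, applied to \<open>a = f (x (t - s)) / f (x t)\<close>.\<close>

lemma delay_rhs_ge:
  assumes "0 \<le> t" shows "f (x t) * (measure \<mu> {0..t} - log_f_defect t) \<le> delay_rhs f \<mu> x t"
proof -
  have int: "integrable \<mu> (\<lambda>s. indicator {..t} s * (log_f t - log_f (t - s)))"
    by (rule integrable_mu_bounded[where c="log_f t - log_f 0"])
       (use log_f_increment_bounds[of _ t t] monoD[OF log_f_mono \<open>0 \<le> t\<close>] in \<open>auto simp: indicator_def\<close>)
  have int1: "integrable \<mu> (\<lambda>s. indicator {..t} s * (1::real))"
    by (rule integrable_mu_bounded[where c=1]) (auto simp: indicator_def)
  have "measure \<mu> {0..t} - log_f_defect t
      = (\<integral>s. indicator {..t} s * 1 - indicator {..t} s * (log_f t - log_f (t - s)) \<partial>\<mu>)"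
    unfolding log_f_defect_def Bochner_Integration.integral_diff[OF int1 int]
    using integral_indicator_mu[OF assms, of 1] by simp
  then have "exp (log_f t) * (measure \<mu> {0..t} - log_f_defect t)
      = (\<integral>s. exp (log_f t) * (indicator {..t} s * 1 - indicator {..t} s * (log_f t - log_f (t - s))) \<partial>\<mu>)"
    by simp
  also have "\<dots> \<le> (\<integral>s. indicator {..t} s * exp (log_f (t - s)) \<partial>\<mu>)"
  proof (rule integral_mono)
    show "integrable \<mu> (\<lambda>s. exp (log_f t) * (indicator {..t} s * 1 - indicator {..t} s * (log_f t - log_f (t - s))))"
      using int int1 by (intro integrable_mult_right Bochner_Integration.integrable_diff)
    show "integrable \<mu> (\<lambda>s. indicator {..t} s * exp (log_f (t - s)))"
      by (rule integrable_mu_bounded[where c="exp (log_f t)"])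
         (use monoD[OF log_f_mono] in \<open>auto simp: indicator_def\<close>)
    fix s assume "s \<in> space \<mu>"
    have "exp (log_f t) * (1 + (log_f (t - s) - log_f t)) \<le> exp (log_f t) * exp (log_f (t - s) - log_f t)"
      by (intro mult_left_mono exp_ge_add_one_self) auto
    also have "\<dots> = exp (log_f (t - s))" by (simp flip: exp_add)
    finally show "exp (log_f t) * (indicator {..t} s * 1 - indicator {..t} s * (log_f t - log_f (t - s)))
        \<le> indicator {..t} s * exp (log_f (t - s))"
      by (auto simp: indicator_def algebra_simps)
  qed
  finally show ?thesis
    by (simp only: delay_rhs_eq[symmetric] exp_log_f[OF assms])
qed

section \<open>The tail integral and the truncated moment of the measure\<close>

lemma tail_has_integral:
  "((\<lambda>s. measure \<mu> {s..}) has_integral tail_integral \<mu> T) {0..T}"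
proof -
  \<comment> \<open>For \<open>s < 0\<close> the set \<open>{s..}\<close> lies outside
    \<open>sets \<mu>\<close> and gets measure 0. With \<open>max 0 s\<close> the tail is
    nonincreasing on the whole line, hence Borel.\<close>
  define g where "g s = measure \<mu> {max 0 s..}" for s
  have sets: "{max 0 s..} \<in> sets \<mu>" for s by (auto simp: sets_mu_iff)
  have "mono (\<lambda>s. - g s)"
    unfolding g_def using sets by (intro monoI le_imp_neg_le finite_measure_mono) auto
  then have "(\<lambda>s. - g s) \<in> borel_measurable borel" by (rule borel_measurable_mono)
  then have g_meas: "g \<in> borel_measurable borel" by simp
  have "set_integrable lborel {0..T} g"
    unfolding set_integrable_def
  proof (rule integrableI_bounded_set[where A="{0..T}" and B=M])
    show "AE s in lborel. s \<in> {0..T} \<longrightarrow> norm (indicator {0..T} s *\<^sub>R g s) \<le> M"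
      by (auto simp: g_def M_eq intro!: bounded_measure)
  qed (use g_meas in \<open>auto simp: emeasure_lborel_Icc_eq\<close>)
  moreover have "(LBINT s:{0..T}. g s) = tail_integral \<mu> T"
    unfolding tail_integral_def by (intro set_lebesgue_integral_cong) (auto simp: g_def max_def)
  ultimately have "(g has_integral tail_integral \<mu> T) {0..T}"
    using set_borel_integral_eq_integral[of "{0..T}" g] by (simp add: has_integral_iff)
  then show ?thesis
    by (rule has_integral_eq[rotated]) (auto simp: g_def max_def)
qed

lemma tail_integral_nonneg: "0 \<le> tail_integral \<mu> T"
  by (rule has_integral_nonneg[OF tail_has_integral]) auto

lemma tail_integral_mono: "T \<le> T' \<Longrightarrow> tail_integral \<mu> T \<le> tail_integral \<mu> T'"
  by (rule has_integral_subset_le[OF _ tail_has_integral tail_has_integral]) auto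

lemma truncated_moment_nonneg: "0 \<le> truncated_moment \<mu> T"
  unfolding truncated_moment_def set_lebesgue_integral_def
  by (intro Bochner_Integration.integral_nonneg) (auto simp: indicator_def)

text \<open>The point \<open>s\<close> lies in both sets, so its mass is counted twice. This atom is
  the error made when \<open>measure \<mu> {0..s}\<close> is replaced by
  \<open>M - measure \<mu> {s..}\<close>.\<close>

lemma measure_tail_split:
  assumes "0 \<le> s" shows "measure \<mu> {0..s} + measure \<mu> {s..} = M + measure \<mu> {s}"
proof -
  have eq: "{0..} = {0..s} \<union> {s<..}" "{s..} = {s} \<union> {s<..}" using assms by auto
  have "M = measure \<mu> {0..s} + measure \<mu> {s<..}"
    unfolding M_def eq(1) using assms by (intro finite_measure_Union) (auto simp: sets_mu_iff)
  moreover have "measure \<mu> {s..} = measure \<mu> {s} + measure \<mu> {s<..}"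
    unfolding eq(2) using assms by (intro finite_measure_Union) (auto simp: sets_mu_iff)
  ultimately show ?thesis by simp
qed

section \<open>Two-sided estimates for \<open>Fint f (x t)\<close>\<close>

lemma Fint_x_has_integral:
  assumes "0 \<le> t"
  shows "((\<lambda>s. 1 / f (x s) * delay_rhs f \<mu> x s) has_integral (Fint f (x t) - Fint f \<psi>)) {0..t}"
proof -
  have f_pos_x: "0 \<le> s \<Longrightarrow> 0 < f (x s)" for s by (intro f_pos x_pos)
  have x_cont': "continuous_on {0..t} x" by (rule continuous_on_subset[OF x_cont]) auto
  have "((\<lambda>s. 1 / f (x s) * delay_rhs f \<mu> x s) has_integral (Fint f (x t) - Fint f (x 0))) {0..t}"
  \<comment> \<open>The weight \<open>1 / f (x s)\<close> is nonincreasing in \<open>s\<close>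
    because \<open>f\<close> and \<open>x\<close> are nondecreasing, and
    \<open>Fint_diff_bounds\<close> supplies the two increment bounds for
    \<open>H = Fint f \<circ> x\<close>.\<close>
  proof (rule stieltjes_chain_rule[OF assms, where x=x and K="f (x t) * M"])
    fix s assume s: "s \<in> {0..t}"
    have "delay_rhs f \<mu> x s \<le> f (x s) * measure \<mu> {0..s}" using delay_rhs_le s by auto
    also have "\<dots> \<le> f (x t) * M"
      unfolding M_eq using s f_pos_x[of t]
      by (intro mult_mono f_mono x_pos x_mono bounded_measure measure_nonneg) auto
    finally show "delay_rhs f \<mu> x s \<le> f (x t) * M" .
  next
    have "continuous_on {0..t} (\<lambda>s. f (x s))"
      by (rule continuous_on_compose2[OF f_continuous_on[OF order_refl] x_cont']) (auto intro: x_pos)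
    then show "continuous_on {0..t} (\<lambda>s. 1 / f (x s))"
      using f_pos_x by (intro continuous_intros) (auto simp: less_imp_neq[symmetric])
  next
    fix s t' assume st: "0 \<le> s" "s \<le> t'" "t' \<le> t"
    show "1 / f (x t') \<le> 1 / f (x s)"
      using st f_pos_x by (intro frac_le f_mono x_mono x_pos) auto
    show "1 / f (x t') * (x t' - x s) \<le> Fint f (x t') - Fint f (x s)"
      "Fint f (x t') - Fint f (x s) \<le> 1 / f (x s) * (x t' - x s)"
      using Fint_diff_bounds[of "x s" "x t'"] x_mono[of s t'] x_pos[of s] st by auto
  qed (auto simp: x_0 x_integral delay_rhs_nonneg)
  then show ?thesis by (simp add: x_0)
qed

lemma M_minus_tail_has_integral:
  "0 \<le> T \<Longrightarrow> ((\<lambda>s. M - measure \<mu> {s..}) has_integral (M * T - tail_integral \<mu> T)) {0..T}"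
  using has_integral_diff[OF has_integral_const_real[of M 0 T] tail_has_integral[of T]] by (simp add: mult.commute)

text \<open>Divide \<open>delay_rhs_le\<close> by \<open>f (x s)\<close>, replace
  \<open>measure \<mu> {0..s}\<close> by \<open>M - measure \<mu> {s..}\<close> away from the atoms,
  and integrate.\<close>

lemma Fint_x_upper:
  assumes "0 \<le> t"
  shows "Fint f (x t) \<le> Fint f \<psi> + M * t - tail_integral \<mu> t"
proof -
  define N where "N = {s. measure \<mu> {s} \<noteq> 0}"
  have "negligible N" 
    unfolding N_def negligible_iff_null_sets
    by (intro null_sets_completionI countable_imp_null_set_lborel countable_support)
  \<comment> \<open>A finite measure has countably many atoms. There the majorant is redefined as
    the integrand itself, so the comparison holds at every point and the integral is
    unchanged.\<close>
  then have "((\<lambda>s. if s \<in> N then 1 / f (x s) * delay_rhs f \<mu> x s else M - measure \<mu> {s..})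
      has_integral (M * t - tail_integral \<mu> t)) {0..t}"
    by (rule has_integral_spike[OF _ _ M_minus_tail_has_integral[OF assms]]) auto
  with Fint_x_has_integral[OF assms] have "Fint f (x t) - Fint f \<psi> \<le> M * t - tail_integral \<mu> t"
  proof (rule has_integral_le)
    fix s assume "s \<in> {0..t}"
    then have s: "0 \<le> s" by simp
    show "1 / f (x s) * delay_rhs f \<mu> x s
        \<le> (if s \<in> N then 1 / f (x s) * delay_rhs f \<mu> x s else M - measure \<mu> {s..})"
      using delay_rhs_le[OF s] measure_tail_split[OF s] f_pos[OF x_pos[OF s]]
      by (auto simp: N_def field_simps)
  qed
  then show ?thesis by simp
qed

text \<open>Fubini moves the time integral inside. For a fixed delay \<open>r\<close> it is an
  integral of delayed increments over \<open>{r..T}\<close>, at most \<open>r\<close> times the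
  total increment; integrating in \<open>r\<close> gives the truncated moment.\<close>

lemma log_f_defect_integral:
  assumes T: "0 \<le> T"
  obtains \<beta> where "(log_f_defect has_integral \<beta>) {0..T}"
    "\<beta> \<le> truncated_moment \<mu> T * (log_f T - log_f 0)"
proof -
  \<comment> \<open>The joint integrand, cut to delays \<open>r \<le> s \<le> T\<close>. It is
    bounded and lives on a set of finite product measure, hence integrable.\<close>
  define K where "K s r = (if 0 \<le> s \<and> s \<le> T \<and> r \<le> s then log_f s - log_f (s - r) else 0)" for s r
  interpret P: pair_sigma_finite lborel \<mu> ..
  have [measurable]: "(\<lambda>p. snd p) \<in> borel_measurable (lborel \<Otimes>\<^sub>M \<mu>)"
    by (rule measurable_compose[OF measurable_snd borel_measurable_mu]) simp
  have "case_prod K \<in> borel_measurable (lborel \<Otimes>\<^sub>M \<mu>)"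
    unfolding K_def case_prod_beta by measurable
  then have K_int: "integrable (lborel \<Otimes>\<^sub>M \<mu>) (case_prod K)"
  proof (rule integrableI_bounded_set[where A="{0..T} \<times> space \<mu>" and B="log_f T - log_f 0", rotated])
    show "emeasure (lborel \<Otimes>\<^sub>M \<mu>) ({0..T} \<times> space \<mu>) < \<infinity>"
      using T by (subst emeasure_pair_measure_Times) (auto simp: ennreal_mult_eq_top_iff less_top[symmetric])
    show "AE p in lborel \<Otimes>\<^sub>M \<mu>. p \<in> {0..T} \<times> space \<mu> \<longrightarrow> norm (case_prod K p) \<le> log_f T - log_f 0"
      using log_f_increment_bounds[of _ _ T] monoD[OF log_f_mono T] by (auto simp: K_def space_mu)
    show "AE p in lborel \<Otimes>\<^sub>M \<mu>. p \<notin> {0..T} \<times> space \<mu> \<longrightarrow> case_prod K p = 0"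
      by (rule AE_I2) (auto simp: K_def space_pair_measure split: if_splits)
  qed auto
  have inner: "(\<integral>r. K s r \<partial>\<mu>) = indicator {0..T} s *\<^sub>R log_f_defect s" for s
    unfolding log_f_defect_def
    by (auto simp: K_def indicator_def intro!: Bochner_Integration.integral_cong)
  have "set_integrable lborel {0..T} log_f_defect"
    using P.integrable_fst[OF K_int] by (simp add: inner set_integrable_def)
  then have int: "(log_f_defect has_integral (LBINT s:{0..T}. log_f_defect s)) {0..T}"
    using set_borel_integral_eq_integral by (metis integrable_integral)
  have "(LBINT s:{0..T}. log_f_defect s) = (\<integral>r. (\<integral>s. K s r \<partial>lborel) \<partial>\<mu>)"
    unfolding set_lebesgue_integral_def inner[symmetric] by (rule P.Fubini_integral[OF K_int, symmetric])
  \<comment> \<open>For \<open>r > T\<close> the slice of \<open>K\<close> vanishes, so only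
    \<open>r\<close> in \<open>{0..T}\<close> contributes.\<close>
  also have "\<dots> \<le> (\<integral>r. indicator {0..T} r * r * (log_f T - log_f 0) \<partial>\<mu>)"
  proof (rule integral_mono)
    show "integrable \<mu> (\<lambda>r. \<integral>s. K s r \<partial>lborel)" by (rule P.integrable_snd[OF K_int])
    show "integrable \<mu> (\<lambda>r. indicator {0..T} r * r * (log_f T - log_f 0))"
      by (rule integrable_mu_bounded[where c="T * (log_f T - log_f 0)"])
         (use T monoD[OF log_f_mono T] in \<open>auto simp: indicator_def intro!: mult_right_mono\<close>)
    fix r assume "r \<in> space \<mu>"
    then have r: "0 \<le> r" by (simp add: space_mu)
    show "(\<integral>s. K s r \<partial>lborel) \<le> indicator {0..T} r * r * (log_f T - log_f 0)"
    proof (cases "r \<le> T")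
      case True
      have "set_integrable lborel {r..T} (\<lambda>s. log_f s - log_f (s - r))"
        by (intro borel_integrable_compact[unfolded set_integrable_def[symmetric]] continuous_intros
            continuous_on_compose2[OF log_f_cont] continuous_on_subset[OF log_f_cont]) auto
      then have "(LBINT s:{r..T}. log_f s - log_f (s - r)) \<le> r * (log_f T - log_f 0)"
        using integral_delayed_increment_le[OF log_f_cont log_f_mono r True]
        by (simp add: set_borel_integral_eq_integral)
      moreover have "(LBINT s:{r..T}. log_f s - log_f (s - r)) = (\<integral>s. K s r \<partial>lborel)"
        unfolding set_lebesgue_integral_def using r
        by (intro Bochner_Integration.integral_cong) (auto simp: K_def indicator_def)
      ultimately show ?thesis using r True by simp
    next
      case False
      then have "K s r = 0" for s by (auto simp: K_def)
      then show ?thesis using False by simp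
    qed
  qed
  also have "\<dots> = truncated_moment \<mu> T * (log_f T - log_f 0)"
    by (simp add: truncated_moment_def set_lebesgue_integral_def)
  finally show thesis by (rule that[OF int])
qed

text \<open>Divide \<open>delay_rhs_ge\<close> by \<open>f (x s)\<close> and integrate; the defect
  costs at most the truncated moment times the increment of \<open>ln (f (x t))\<close>.\<close>

lemma Fint_x_lower:
  assumes t: "0 \<le> t"
  shows "Fint f \<psi> + M * t - tail_integral \<mu> t - truncated_moment \<mu> t * (ln (f (x t)) - ln (f \<psi>))
    \<le> Fint f (x t)"
proof -
  obtain \<beta> where \<beta>: "(log_f_defect has_integral \<beta>) {0..t}"
    "\<beta> \<le> truncated_moment \<mu> t * (log_f t - log_f 0)"
    using log_f_defect_integral[OF t] .
  have "M * t - tail_integral \<mu> t - \<beta> \<le> Fint f (x t) - Fint f \<psi>"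
  proof (rule has_integral_le[OF has_integral_diff[OF M_minus_tail_has_integral[OF t] \<beta>(1)] Fint_x_has_integral[OF t]])
    fix s assume "s \<in> {0..t}"
    then have s: "0 \<le> s" by simp
    \<comment> \<open>The mass at \<open>s\<close> has the favourable sign here, so no null set has
      to be removed.\<close>
    have "M - measure \<mu> {s..} - log_f_defect s \<le> measure \<mu> {0..s} - log_f_defect s"
      using measure_tail_split[OF s] measure_nonneg[of \<mu> "{s}"] by linarith
    also have "\<dots> \<le> 1 / f (x s) * delay_rhs f \<mu> x s"
      using delay_rhs_ge[OF s] f_pos[OF x_pos[OF s]] by (auto simp: field_simps)
    finally show "M - measure \<mu> {s..} - log_f_defect s \<le> 1 / f (x s) * delay_rhs f \<mu> x s" .
  qed
  with \<beta>(2) t show ?thesis by (simp add: log_f_def x_0 max_def)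
qed

section \<open>Comparison with the undelayed problem \<open>y' = M * f y\<close>,
  \<open>y 0 = 1\<close>\<close>

abbreviation (input) y :: "real \<Rightarrow> real" where "y t \<equiv> Fint_inv f (M * t)"

lemma y_pos: "0 \<le> t \<Longrightarrow> 0 < y t" and Fint_y: "0 \<le> t \<Longrightarrow> Fint f (y t) = M * t"
  using Fint_inv[of "M * t"] M_nonneg by auto

lemma y_at_top: "0 < M \<Longrightarrow> filterlim y at_top at_top"
  by (rule filterlim_compose[OF Fint_inv_at_top])
     (auto intro: filterlim_tendsto_pos_mult_at_top[OF tendsto_const] filterlim_ident)

text \<open>The substitution \<open>u = y t\<close>, that is \<open>t = Fint f u / M\<close>: both
  maps tend to infinity and are eventually inverse to each other. It restates limits in
  \<open>u\<close> as limits in \<open>t\<close>.\<close>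

lemma filterlim_Fint_iff:
  assumes M: "0 < M"
  shows "filterlim (\<lambda>u. G u (Fint f u / M)) F at_top \<longleftrightarrow> filterlim (\<lambda>t. G (y t) t) F at_top"
proof
  assume "filterlim (\<lambda>u. G u (Fint f u / M)) F at_top"
  from filterlim_compose[OF this y_at_top[OF M]]
  show "filterlim (\<lambda>t. G (y t) t) F at_top"
    by (rule filterlim_mono_eventually[OF _ order_refl order_refl])
       (use eventually_ge_at_top[of 0] in eventually_elim, use M in \<open>simp add: Fint_y\<close>)
next
  assume *: "filterlim (\<lambda>t. G (y t) t) F at_top"
  have "filterlim (\<lambda>u. Fint f u / M) at_top at_top"
    using filterlim_tendsto_pos_mult_at_top[OF tendsto_const[of "1 / M"] _ Fint_at_top] M by simp
  from filterlim_compose[OF * this]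
  show "filterlim (\<lambda>u. G u (Fint f u / M)) F at_top"
  proof (rule filterlim_mono_eventually[OF _ order_refl order_refl])
    show "\<forall>\<^sub>F u in at_top. G (y (Fint f u / M)) (Fint f u / M) = G u (Fint f u / M)"
      using eventually_gt_at_top[of 1]
    proof eventually_elim
      case (elim u)
      \<comment> \<open>\<open>Fint_inv f\<close> is controlled on nonnegative arguments, which is
        why \<open>u > 1\<close> is taken.\<close>
      then have "0 \<le> Fint f u" using Fint_strict_mono[of 1 u] by simp
      then have "Fint_inv f (Fint f u) = u"
        using Fint_inv[of "Fint f u"] Fint_less_iff[of u "Fint_inv f (Fint f u)"]
          Fint_less_iff[of "Fint_inv f (Fint f u)" u] elim by simp
      then show ?case using M by simp
    qed
  qed
qed

section \<open>Bounds for \<open>x t / y t\<close>, and statement (i)\<close>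

lemma f_y_over_y_tendsto_0: "0 < M \<Longrightarrow> ((\<lambda>t. f (y t) / y t) \<longlongrightarrow> 0) at_top"
  by (rule filterlim_compose[OF f_over_id_tendsto_0 y_at_top])

text \<open>As the tail integral is nonnegative, \<open>Fint_x_upper\<close> gives
  \<open>Fint f (x t) - Fint f (y t) \<le> \<bar>Fint f \<psi>\<bar>\<close>: any excess of
  \<open>x\<close> over \<open>y\<close> is due to the initial value.\<close>

lemma x_over_y_upper:
  assumes M: "0 < M"
  shows "\<forall>\<^sub>F t in at_top. x t / y t \<le> 1 + 2 * \<bar>Fint f \<psi>\<bar> * (f (y t) / y t)"
proof -
  define C where "C = \<bar>Fint f \<psi>\<bar>"
  \<comment> \<open>With this slope, \<open>C\<close> times the increment of \<open>f\<close> is at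
    most half of \<open>x t - y t\<close> and is absorbed on the left, which doubles
    \<open>C\<close>. The summand 1 allows \<open>C = 0\<close>.\<close>
  obtain u0 where u0: "u0 > 0" "\<And>a b. u0 \<le> a \<Longrightarrow> a \<le> b \<Longrightarrow> f b - f a \<le> 1 / (2 * (C + 1)) * (b - a)"
    by (rule f_increment_eventually[of "1 / (2 * (C + 1))"]) (auto simp: C_def)
  have "\<forall>\<^sub>F t in at_top. u0 \<le> y t"
    using y_at_top[OF M] by (simp add: filterlim_at_top)
  with eventually_ge_at_top[of 0] have "\<forall>\<^sub>F t in at_top. x t / y t \<le> 1 + 2 * C * (f (y t) / y t)"
  proof eventually_elim
    case (elim t)
    note pos = y_pos[OF elim(1)] x_pos[OF elim(1)]
    have "x t \<le> y t + 2 * C * f (y t)"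
    proof (cases "x t \<le> y t")
      case True
      have "0 \<le> 2 * C * f (y t)" using f_pos[OF pos(1)] by (simp add: C_def)
      with True show ?thesis by simp
    next
      case False
      then have less: "y t \<le> x t" by simp
      have "(x t - y t) / f (x t) \<le> C"
        using Fint_diff_bounds(1)[OF pos(1) less] Fint_x_upper[OF elim(1)] Fint_y[OF elim(1)]
          tail_integral_nonneg[of t] by (simp add: C_def)
      then have "x t - y t \<le> C * f (x t)"
        using f_pos[OF pos(2)] by (simp add: divide_le_eq)
      also have "f (x t) \<le> f (y t) + 1 / (2 * (C + 1)) * (x t - y t)"
        using u0(2)[OF elim(2) less] by simp
      then have "C * f (x t) \<le> C * (f (y t) + 1 / (2 * (C + 1)) * (x t - y t))"
        by (intro mult_left_mono) (auto simp: C_def)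
      also have "\<dots> = C * f (y t) + (C / (C + 1)) * ((x t - y t) / 2)"
        by (simp add: C_def field_simps)
      also have "(C / (C + 1)) * ((x t - y t) / 2) \<le> 1 * ((x t - y t) / 2)"
        using less by (intro mult_right_mono) (auto simp: C_def divide_simps)
      finally show ?thesis by (simp add: field_simps)
    qed
    then show ?case using pos by (simp add: field_simps)
  qed
  then show ?thesis by (simp add: C_def)
qed

text \<open>If \<open>x t < y t\<close>, then \<open>(y t - x t) / f (y t)\<close> is at most
  \<open>Fint f (y t) - Fint f (x t)\<close>, which \<open>Fint_x_lower\<close> bounds. Multiplying
  by \<open>f (y t) / y t\<close> produces the quantities of statement (i).\<close>

lemma x_over_y_lower:
  assumes M: "0 < M"
  shows "\<forall>\<^sub>F t in at_top. 1 - (f (y t) / y t * tail_integral \<mu> t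
      + 2 * (f (y t) / (y t / ln (y t)) * truncated_moment \<mu> t)
      + \<bar>Fint f \<psi>\<bar> * (f (y t) / y t)) \<le> x t / y t"
proof -
  have "\<forall>\<^sub>F t in at_top. exp \<bar>ln (f \<psi>)\<bar> \<le> y t"
    using y_at_top[OF M] by (simp add: filterlim_at_top)
  moreover have "\<forall>\<^sub>F t in at_top. f (y t) \<le> y t"
    using eventually_compose_filterlim[OF f_le_id_eventually y_at_top[OF M]] .
  ultimately show ?thesis
    using eventually_ge_at_top[of 0]
  proof eventually_elim
    case (elim t)
    note pos = y_pos[OF elim(3)] x_pos[OF elim(3)]
    note f_pos_y = f_pos[OF pos(1)]
    let ?R = "tail_integral \<mu> t" and ?m = "truncated_moment \<mu> t" and ?C = "\<bar>Fint f \<psi>\<bar>"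
    \<comment> \<open>The threshold on \<open>y t\<close> serves this bound. With
      \<open>f (y t) \<le> y t\<close> it gives
      \<open>ln (f (x t)) - ln (f \<psi>) \<le> 2 * ln (y t)\<close> when
      \<open>x t \<le> y t\<close>, hence the factor 2.\<close>
    have ln_y: "\<bar>ln (f \<psi>)\<bar> \<le> ln (y t)" using elim(1) pos(1) by (simp add: ln_ge_iff)
    have nonneg: "0 \<le> ?R + ?m * (2 * ln (y t)) + ?C"
      using tail_integral_nonneg truncated_moment_nonneg ln_y by (intro add_nonneg_nonneg mult_nonneg_nonneg) auto
    have "y t - x t \<le> f (y t) * (?R + ?m * (2 * ln (y t)) + ?C)"
    proof (cases "y t \<le> x t")
      case True
      have "0 \<le> f (y t) * (?R + ?m * (2 * ln (y t)) + ?C)"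
        using nonneg f_pos_y by simp
      with True show ?thesis by simp
    next
      case False
      then have less: "x t \<le> y t" by simp
      have "ln (f (x t)) \<le> ln (y t)"
        using f_mono[OF pos(2) less] elim(2) f_pos[OF pos(2)] by simp
      then have "?m * (ln (f (x t)) - ln (f \<psi>)) \<le> ?m * (2 * ln (y t))"
        using ln_y truncated_moment_nonneg by (intro mult_left_mono) auto
      then have "(y t - x t) / f (y t) \<le> ?R + ?m * (2 * ln (y t)) + ?C"
        using Fint_diff_bounds(1)[OF pos(2) less] Fint_x_lower[OF elim(3)] Fint_y[OF elim(3)] by linarith
      then show ?thesis using f_pos_y by (simp add: divide_le_eq mult.commute)
    qed
    then have "(y t - x t) / y t \<le> f (y t) * (?R + ?m * (2 * ln (y t)) + ?C) / y t"
      using pos(1) by (intro divide_right_mono) auto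
    then show ?case using pos(1) by (simp add: diff_divide_distrib add_divide_distrib algebra_simps)
  qed
qed

theorem ratio_tendsto_1:
  assumes M: "0 < M"
    and moment: "((\<lambda>u. f u / (u / ln u) * truncated_moment \<mu> (Fint f u / M)) \<longlongrightarrow> 0) at_top"
    and tail: "((\<lambda>u. f u / u * tail_integral \<mu> (Fint f u / M)) \<longlongrightarrow> 0) at_top"
  shows "((\<lambda>t. x t / y t) \<longlongrightarrow> 1) at_top"
proof (rule tendsto_sandwich[OF x_over_y_lower[OF M] x_over_y_upper[OF M]])
  note f_y = f_y_over_y_tendsto_0[OF M]
  have "((\<lambda>t. f (y t) / (y t / ln (y t)) * truncated_moment \<mu> t) \<longlongrightarrow> 0) at_top"
    using moment filterlim_Fint_iff[OF M, of "\<lambda>u t. f u / (u / ln u) * truncated_moment \<mu> t"] by simp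
  moreover have "((\<lambda>t. f (y t) / y t * tail_integral \<mu> t) \<longlongrightarrow> 0) at_top"
    using tail filterlim_Fint_iff[OF M, of "\<lambda>u t. f u / u * tail_integral \<mu> t"] by simp
  ultimately have "((\<lambda>t. 1 - (f (y t) / y t * tail_integral \<mu> t
      + 2 * (f (y t) / (y t / ln (y t)) * truncated_moment \<mu> t)
      + \<bar>Fint f \<psi>\<bar> * (f (y t) / y t))) \<longlongrightarrow> 1 - (0 + 2 * 0 + \<bar>Fint f \<psi>\<bar> * 0)) at_top"
    by (intro tendsto_intros f_y)
  then show "((\<lambda>t. 1 - (f (y t) / y t * tail_integral \<mu> t
      + 2 * (f (y t) / (y t / ln (y t)) * truncated_moment \<mu> t)
      + \<bar>Fint f \<psi>\<bar> * (f (y t) / y t))) \<longlongrightarrow> 1) at_top" by simp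
  have "((\<lambda>t. 1 + 2 * \<bar>Fint f \<psi>\<bar> * (f (y t) / y t)) \<longlongrightarrow> 1 + 2 * \<bar>Fint f \<psi>\<bar> * 0) at_top"
    by (intro tendsto_intros f_y)
  then show "((\<lambda>t. 1 + 2 * \<bar>Fint f \<psi>\<bar> * (f (y t) / y t)) \<longlongrightarrow> 1) at_top" by simp
qed

section \<open>Statement (ii), by contradiction from
  \<open>x t \<ge> \<epsilon> * y t\<close>\<close>

theorem ratio_tendsto_0:
  assumes M: "0 < M"
    and tail: "filterlim (\<lambda>u. f u / u * tail_integral \<mu> (Fint f u / M)) at_top at_top"
  shows "((\<lambda>t. x t / y t) \<longlongrightarrow> 0) at_top"
proof (rule order_tendstoI)
  fix a :: real assume "a < 0"
  show "\<forall>\<^sub>F t in at_top. a < x t / y t"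
    using eventually_ge_at_top[of 0]
  proof eventually_elim
    case (elim t)
    have "0 < x t / y t" using x_pos[OF elim] y_pos[OF elim] by simp
    with \<open>a < 0\<close> show ?case by linarith
  qed
next
  fix \<epsilon> :: real assume \<epsilon>: "0 < \<epsilon>"
  define C where "C = \<bar>Fint f \<psi>\<bar>"
  \<comment> \<open>The first entry makes the tail integral exceed \<open>2 * C\<close>, the second
    makes \<open>\<bar>ln \<epsilon>\<bar> / K\<close> less than \<open>1 / 2\<close>.\<close>
  define K where "K = max (2 * (C + 1)) (2 * \<bar>ln \<epsilon>\<bar> + 1)"
  have K: "2 * (C + 1) \<le> K" "2 * \<bar>ln \<epsilon>\<bar> < K" "0 < K" by (auto simp: K_def C_def)
  have "\<forall>\<^sub>F u in at_top. K \<le> f u / u * tail_integral \<mu> (Fint f u / M)"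
    using tail by (simp add: filterlim_at_top)
  with f_le_id_eventually have "\<forall>\<^sub>F u in at_top. f u \<le> u \<and> K \<le> f u / u * tail_integral \<mu> (Fint f u / M)"
    by eventually_elim simp
  then obtain u0 where u0: "\<And>u. u0 \<le> u \<Longrightarrow> f u \<le> u \<and> K \<le> f u / u * tail_integral \<mu> (Fint f u / M)"
    by (auto simp: eventually_at_top_linorder)
  have "\<forall>\<^sub>F t in at_top. max u0 (u0 / \<epsilon>) \<le> y t"
    using y_at_top[OF M] by (simp only: filterlim_at_top)
  with eventually_ge_at_top[of 0] show "\<forall>\<^sub>F t in at_top. x t / y t < \<epsilon>"
  proof eventually_elim
    case (elim t)
    note pos = y_pos[OF elim(1)] x_pos[OF elim(1)]
    let ?R = "tail_integral \<mu> t"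
    have Fint_yM: "Fint f (y t) / M = t" using M by (simp add: Fint_y[OF elim(1)])
    show ?case
    proof (rule ccontr)
      assume "\<not> x t / y t < \<epsilon>"
      then have ge: "\<epsilon> * y t \<le> x t" using pos by (simp add: not_less pos_le_divide_eq)
      have y_ge: "u0 \<le> y t" "u0 / \<epsilon> \<le> y t" using elim(2) by auto
      \<comment> \<open>The threshold \<open>u0 / \<epsilon>\<close> puts all of
        \<open>{x t..y t}\<close> into the range where the hypothesis applies.\<close>
      have u0_le: "u0 \<le> x t" using ge y_ge(2) \<epsilon> by (simp add: pos_divide_le_eq mult.commute)
      have "K \<le> f (y t) / y t * ?R" using u0[OF y_ge(1)] Fint_yM by simp
      also have "\<dots> \<le> 1 * ?R"
        using u0[OF y_ge(1)] pos tail_integral_nonneg by (intro mult_right_mono) (auto simp: divide_simps)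
      finally have R: "2 * (C + 1) \<le> ?R" using K by simp
      have diff: "?R - C \<le> Fint f (y t) - Fint f (x t)"
        using Fint_x_upper[OF elim(1)] Fint_y[OF elim(1)] by (simp add: C_def)
      then have "Fint f (x t) < Fint f (y t)" using R by (simp add: C_def)
      then have less: "x t < y t" using pos by (simp add: Fint_less_iff)
      have "Fint f (y t) - Fint f (x t) \<le> ?R / K * (ln (y t) - ln (x t))"
      proof (rule Fint_diff_le_ln[OF pos(2) less_imp_le[OF less]])
        fix u assume u: "x t \<le> u" "u \<le> y t"
        with pos have "0 < u" by simp
        \<comment> \<open>Since \<open>u \<le> y t\<close>, the time \<open>Fint f u / M\<close> is
          at most \<open>t\<close>. So the tail integral at that time can be replaced by the
          constant \<open>tail_integral \<mu> t\<close>.\<close>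
        have "Fint f u \<le> M * t"
          using Fint_mono[OF \<open>0 < u\<close> u(2)] by (simp only: Fint_y[OF elim(1)])
        then have "Fint f u / M \<le> t"
          using M by (simp add: divide_le_eq mult.commute)
        then have "tail_integral \<mu> (Fint f u / M) \<le> ?R" by (rule tail_integral_mono)
        then have "f u / u * tail_integral \<mu> (Fint f u / M) \<le> f u / u * ?R"
          using f_pos[OF \<open>0 < u\<close>] \<open>0 < u\<close> by (intro mult_left_mono) auto
        with u0[of u] u u0_le have "K \<le> f u / u * ?R" by linarith
        then show "1 / f u \<le> ?R / K / u"
          using K(3) f_pos[OF \<open>0 < u\<close>] \<open>0 < u\<close> by (simp add: field_simps)
      qed
      also have "\<dots> \<le> ?R / K * \<bar>ln \<epsilon>\<bar>"
      proof (rule mult_left_mono)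
        have "ln (\<epsilon> * y t) \<le> ln (x t)" using ge \<epsilon> pos by (intro ln_mono) auto
        then have "ln \<epsilon> + ln (y t) \<le> ln (x t)" using \<epsilon> pos by (simp add: ln_mult)
        then show "ln (y t) - ln (x t) \<le> \<bar>ln \<epsilon>\<bar>" by linarith
      qed (use K tail_integral_nonneg in auto)
      also have "\<dots> \<le> ?R / 2"
        using mult_left_mono[OF less_imp_le[OF K(2)] tail_integral_nonneg[of t]] K(3) by (simp add: field_simps)
      \<comment> \<open>Now \<open>?R - C \<le> ?R / 2\<close>, against
        \<open>?R \<ge> 2 * (C + 1)\<close>.\<close>
      finally show False using diff R by simp
    qed
  qed
qed

section \<open>Statement (iii): the gap between \<open>y\<close> and \<open>x\<close> controls the
  tail integral\<close>

theorem tail_tendsto_0: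
  assumes M: "0 < M" and c: "0 < c" "antimono_on {c..} f'"
    and ratio: "((\<lambda>t. x t / y t) \<longlongrightarrow> 1) at_top"
  shows "((\<lambda>u. f u / u * tail_integral \<mu> (Fint f u / M)) \<longlongrightarrow> 0) at_top"
proof -
  define C where "C = \<bar>Fint f \<psi>\<bar>"
  have "((\<lambda>t. f (y t) / y t * tail_integral \<mu> t) \<longlongrightarrow> 0) at_top"
  proof (rule tendsto_sandwich[OF _ _ tendsto_const])
    show "\<forall>\<^sub>F t in at_top. 0 \<le> f (y t) / y t * tail_integral \<mu> t"
      using eventually_ge_at_top[of 0]
      by eventually_elim (intro mult_nonneg_nonneg divide_nonneg_pos less_imp_le[OF f_pos] y_pos tail_integral_nonneg)
    have "\<forall>\<^sub>F t in at_top. 1 / 2 < x t / y t"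
      by (rule order_tendstoD(1)[OF ratio]) simp
    moreover have "\<forall>\<^sub>F t in at_top. 4 * c \<le> y t"
      using y_at_top[OF M] by (simp only: filterlim_at_top)
    ultimately show "\<forall>\<^sub>F t in at_top. f (y t) / y t * tail_integral \<mu> t
        \<le> C * (f (y t) / y t) + \<bar>1 - x t / y t\<bar> * (1 + 2 * \<bar>inverse (x t / y t) - 1\<bar>)"
      using eventually_ge_at_top[of 0]
    proof eventually_elim
      case (elim t)
      note pos = y_pos[OF elim(3)] x_pos[OF elim(3)]
      note f_pos_y = f_pos[OF pos(1)] and f_pos_x = f_pos[OF pos(2)]
      have tail: "tail_integral \<mu> t \<le> C + (Fint f (y t) - Fint f (x t))"
        using Fint_x_upper[OF elim(3)] Fint_y[OF elim(3)] by (simp add: C_def)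
      \<comment> \<open>The absolute values keep the majorant nonnegative when
        \<open>x t \<ge> y t\<close>. It depends on \<open>x t / y t\<close> alone, continuously
        near 1, and vanishes at 1.\<close>
      have "f (y t) / y t * (Fint f (y t) - Fint f (x t))
          \<le> \<bar>1 - x t / y t\<bar> * (1 + 2 * \<bar>inverse (x t / y t) - 1\<bar>)"
      proof (cases "x t < y t")
        case True
        have "f (y t) / y t * (Fint f (y t) - Fint f (x t)) \<le> f (y t) / y t * ((y t - x t) / f (x t))"
          using Fint_diff_bounds(2)[OF pos(2) less_imp_le[OF True]] f_pos_y pos by (intro mult_left_mono) auto
        also have "\<dots> = (1 - x t / y t) * (f (y t) / f (x t))"
          using pos by (simp add: field_simps)
        also have "\<dots> \<le> (1 - x t / y t) * (1 + 2 * (y t / x t - 1))"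
        proof (intro mult_left_mono f_ratio_le_of_antimono[OF c _ True])
          \<comment> \<open>The thresholds \<open>1 / 2\<close> for \<open>x t / y t\<close> and
            \<open>4 * c\<close> for \<open>y t\<close> were chosen for this.\<close>
          show "2 * c \<le> x t" using elim(1,2) pos by (simp add: field_simps)
        qed (use True pos in simp)
        also have "\<dots> \<le> \<bar>1 - x t / y t\<bar> * (1 + 2 * \<bar>inverse (x t / y t) - 1\<bar>)"
          using True pos by (intro mult_mono) auto
        finally show ?thesis .
      next
        case False
        then have "Fint f (y t) \<le> Fint f (x t)" using pos by (simp add: Fint_mono)
        then have "f (y t) / y t * (Fint f (y t) - Fint f (x t)) \<le> 0"
          using f_pos_y pos by (intro mult_nonneg_nonpos) auto
        also have "0 \<le> \<bar>1 - x t / y t\<bar> * (1 + 2 * \<bar>inverse (x t / y t) - 1\<bar>)" by simp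
        finally show ?thesis .
      qed
      moreover have "f (y t) / y t * tail_integral \<mu> t \<le> f (y t) / y t * (C + (Fint f (y t) - Fint f (x t)))"
        using tail f_pos_y pos by (intro mult_left_mono) auto
      then have "f (y t) / y t * tail_integral \<mu> t
          \<le> C * (f (y t) / y t) + f (y t) / y t * (Fint f (y t) - Fint f (x t))"
        by (simp only: distrib_left mult.commute[of C])
      ultimately show ?case by linarith
    qed
    have "((\<lambda>t. C * (f (y t) / y t) + \<bar>1 - x t / y t\<bar> * (1 + 2 * \<bar>inverse (x t / y t) - 1\<bar>))
        \<longlongrightarrow> C * 0 + \<bar>1 - 1\<bar> * (1 + 2 * \<bar>inverse 1 - 1\<bar>)) at_top"
      by (intro tendsto_intros ratio f_y_over_y_tendsto_0 M) auto
    then show "((\<lambda>t. C * (f (y t) / y t) + \<bar>1 - x t / y t\<bar> * (1 + 2 * \<bar>inverse (x t / y t) - 1\<bar>))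
        \<longlongrightarrow> 0) at_top" by simp
  qed
  then show ?thesis
    using filterlim_Fint_iff[OF M, of "\<lambda>u t. f u / u * tail_integral \<mu> t"] by simp
qed

end

theorem theorem5:
  fixes f f' x :: "real \<Rightarrow> real" and \<mu> :: "real measure"
    and M \<psi> :: real and lam :: ereal
  assumes f_deriv: "\<And>u. u > 0 \<Longrightarrow> (f has_real_derivative f' u) (at u)"
    and f'_cont: "continuous_on {0<..} f'"
    and f_pos: "\<And>u. u > 0 \<Longrightarrow> f u > 0"
    and f'_pos: "\<And>u. u > 0 \<Longrightarrow> f' u > 0"
    and f'_lim: "(f' \<longlongrightarrow> 0) at_top"
    and lam_range: "lam \<in> {0..\<infinity>}"
    and lam_lim: "((\<lambda>u. ereal (f u / (u / ln u))) \<longlongrightarrow> lam) at_top"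
    and mu_borel: "borel_measure_on_halfline \<mu>"
    and mu_finite: "finite_measure \<mu>"
    and M_def: "M = measure \<mu> {0..}"
    and M_pos: "M > 0"
    and psi_pos: "\<psi> > 0"
    and sol: "delay_solution f \<mu> \<psi> x"
  shows
    "(((\<lambda>u. f u / (u / ln u) * truncated_moment \<mu> (Fint f u / M)) \<longlongrightarrow> 0) at_top \<longrightarrow>
      ((\<lambda>u. f u / u * tail_integral \<mu> (Fint f u / M)) \<longlongrightarrow> 0) at_top \<longrightarrow>
      ((\<lambda>t. x t / Fint_inv f (M * t)) \<longlongrightarrow> 1) at_top)
     \<and>
     (filterlim (\<lambda>u. f u / u * tail_integral \<mu> (Fint f u / M)) at_top at_top \<longrightarrow>
      ((\<lambda>t. x t / Fint_inv f (M * t)) \<longlongrightarrow> 0) at_top)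
     \<and>
     ((\<exists>x\<^sub>2>0. antimono_on {x\<^sub>2..} f') \<longrightarrow>
      ((\<lambda>t. x t / Fint_inv f (M * t)) \<longlongrightarrow> 1) at_top \<longrightarrow>
      ((\<lambda>u. f u / u * tail_integral \<mu> (Fint f u / M)) \<longlongrightarrow> 0) at_top)"
proof -
  interpret finite_measure \<mu> by (rule mu_finite)
  interpret delay_equation f f' \<mu> x M \<psi>
    by unfold_locales (fact f_deriv f_pos f'_pos f'_lim mu_borel M_def sol)+
  show ?thesis
    using ratio_tendsto_1[OF M_pos] ratio_tendsto_0[OF M_pos] tail_tendsto_0[OF M_pos] by blast
qed

end
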